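(* Let $\mathfrak{A}$ be a residuated lattice. The following assertions are equivalent: (1) $\mathfrak{A}$ is Gelfand; (2) the pair $(\rho,Rad)$ is an adjunction on the poset of filters of $\mathfrak{A}$ ordered by inclusion, i.e. for all filters $F,G$ of $\mathfrak{A}$, $\rho(F)\subseteq G$ if and only if $F\subseteq Rad(G)$.
   Context: A residuated lattice is an algebra $\mathfrak{A}=(A;\vee,\wedge,\odot,\rightarrow,0,1)$ such that $(A;\vee,\wedge,0,1)$ is a bounded lattice, $(A;\odot,1)$ is a commutative monoid, and $x\odot y\le z$ iff $x\le y\rightarrow z$ for all $x,y,z\in A$. A filter of $\mathfrak{A}$ is a non-empty subset $F\subseteq A$ such that $x,y\in F$ implies $x\odot y\in F$, and $x\in F$, $y\in A$ imply $x\vee y\in F$. For a family $\mathcal{F}$ of filters, $\veebar\mathcal{F}$ is the filter generated by $\bigcup\mathcal{F}$ (binary version: $F\veebar G$). A filter is proper if it is not $A$; a maximal filter is a maximal element (under inclusion) among proper filters; a prime filter is a proper filter $\mathfrak{p}$ such that $x\vee y\in\mathfrak{p}$ implies $x\in\mathfrak{p}$ or $y\in\mathfrak{p}$. $\mathfrak{A}$ is Gelfand if every prime filter is contained in a unique maximal filter. $Rad(F)$ is the intersection of all maximal filters containing $F$ (an empty intersection is $A$). For a filter $F$, $\sigma(F)$ is the intersection of all prime filters $\mathfrak{q}$ such that $\mathfrak{q}\subseteq\mathfrak{p}$ for some prime filter $\mathfrak{p}\supseteq F$ (an empty intersection is $A$); equivalently $\sigma(F)=\{a\in A\mid F\veebar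 a^{\perp}=A\}$, where $a^{\perp}=\{x\in A\mid x\vee a=1\}$. $\sigma(F)$ is a filter contained in $F$. $F$ is pure if $\sigma(F)=F$. The join $\veebar$ of any family of pure filters is pure, and the pure part of a filter $F$ is $\rho(F)=\veebar\{G\mid G\text{ a pure filter of }\mathfrak{A},\ G\subseteq F\}$, the largest pure filter contained in $F$. *)

theory Defs
  imports Main
begin

text \<open>
  The carrier is the whole type, \<open>\<odot>\<close> is \<open>(*)\<close> and the bounds are \<open>bot\<close> and
  \<open>top\<close>. The case \<open>bot = top\<close> is allowed.
\<close>

class residuated_lattice = bounded_lattice + comm_monoid_mult +
  fixes residuum :: "'a \<Rightarrow> 'a \<Rightarrow> 'a"
  assumes one_eq_top: "1 = top"
    and residuation: "x * y \<le> z \<longleftrightarrow> x \<le> residuum y z"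

definition rl_filter :: "'a::residuated_lattice set \<Rightarrow> bool" where
  "rl_filter F \<longleftrightarrow> F \<noteq> {} \<and> (\<forall>x\<in>F. \<forall>y\<in>F. x * y \<in> F) \<and> (\<forall>x\<in>F. \<forall>y. sup x y \<in> F)"

definition proper_filter :: "'a::residuated_lattice set \<Rightarrow> bool" where
  "proper_filter F \<longleftrightarrow> rl_filter F \<and> F \<noteq> UNIV"

definition maximal_filter :: "'a::residuated_lattice set \<Rightarrow> bool" where
  "maximal_filter M \<longleftrightarrow> proper_filter M \<and> (\<forall>F. proper_filter F \<and> M \<subseteq> F \<longrightarrow> F = M)"

definition prime_filter :: "'a::residuated_lattice set \<Rightarrow> bool" where
  "prime_filter P \<longleftrightarrow> proper_filter P \<and> (\<forall>x y. sup x y \<in> P \<longrightarrow> x \<in> P \<or> y \<in> P)"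

definition generated_filter :: "'a::residuated_lattice set \<Rightarrow> 'a set" where
  "generated_filter X = \<Inter>{F. rl_filter F \<and> X \<subseteq> F}"

definition filter_Join :: "'a::residuated_lattice set set \<Rightarrow> 'a set" where
  "filter_Join \<F> = generated_filter (\<Union>\<F>)"

definition gelfand :: "'a::residuated_lattice itself \<Rightarrow> bool" where
  "gelfand _ \<longleftrightarrow>
    (\<forall>P::'a set. prime_filter P \<longrightarrow> (\<exists>!M. maximal_filter M \<and> P \<subseteq> M))"

text \<open>
  In \<open>Rad\<close> and \<open>sigma\<close>, an empty intersection is \<open>UNIV\<close>, that is, the whole algebra.
\<close>

definition Rad :: "'a::residuated_lattice set \<Rightarrow> 'a set" where
  "Rad F = \<Inter>{M. maximal_filter M \<and> F \<subseteq> M}"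

definition sigma :: "'a::residuated_lattice set \<Rightarrow> 'a set" where
  "sigma F = \<Inter>{Q. prime_filter Q \<and> (\<exists>P. prime_filter P \<and> F \<subseteq> P \<and> Q \<subseteq> P)}"

definition pure_filter :: "'a::residuated_lattice set \<Rightarrow> bool" where
  "pure_filter F \<longleftrightarrow> rl_filter F \<and> sigma F = F"

definition rho :: "'a::residuated_lattice set \<Rightarrow> 'a set" where
  "rho F = filter_Join {G. pure_filter G \<and> G \<subseteq> F}"

end

theory Submission
  imports Defs
begin

text \<open>
  Everything is read off from prime filters. If \<open>H\<close> is pure and contained in a prime filter \<open>P\<close>,
  then \<open>H = \<sigma>(H)\<close> lies in every prime filter below \<open>P\<close>: pure filters can be pushed down along
  inclusions of prime filters (\<open>pure_filter_push_down\<close>), whereas arbitrary filters can only be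
  pushed up. This has two consequences in any residuated lattice.

  First, \<open>F \<subseteq> Rad(G)\<close> always implies \<open>\<rho>(F) \<subseteq> G\<close>. For a pure \<open>H \<subseteq> F\<close> and a prime \<open>P \<supseteq> G\<close>, choose a
  maximal filter above \<open>P\<close>; it contains \<open>F\<close>, hence \<open>H\<close>, and \<open>H\<close> is pushed down into \<open>P\<close>. As \<open>G\<close> is
  the intersection of the prime filters above it, \<open>H \<subseteq> G\<close>.

  Secondly, if a prime filter lies below two maximal filters \<open>M\<close> and \<open>N\<close>, then \<open>\<rho>(M)\<close> is pushed down
  into it and so lies in \<open>N\<close>. Adjointness turns \<open>\<rho>(M) \<subseteq> N\<close> into \<open>M \<subseteq> Rad(N) = N\<close>, so \<open>M = N\<close>, and
  the algebra is Gelfand.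

  It remains to show that \<open>\<rho>(F) \<subseteq> G\<close> implies \<open>F \<subseteq> Rad(G)\<close> in a Gelfand algebra. The heart of the
  matter is that a maximal filter containing \<open>\<sigma>(F)\<close> contains \<open>F\<close> (\<open>gelfand_sigma_le_maximal\<close>). It
  makes \<open>\<sigma>(F)\<close> pure, so that \<open>\<sigma>(F) \<subseteq> \<rho>(F)\<close>, and then sends every maximal filter above
  \<open>G \<supseteq> \<rho>(F)\<close> above \<open>F\<close>.
\<close>

section \<open>Multiplication and filters\<close>

context residuated_lattice
begin

lemma top_mult: "top * x = x"
  using mult_1_left[of x] by (simp add: one_eq_top)

lemma mult_mono_left: "x \<le> y \<Longrightarrow> x * z \<le> y * z"
  using residuation order_trans order_refl by metis

lemma mult_le_left: "x * y \<le> x"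
proof -
  have "y * x \<le> top * x"
    by (rule mult_mono_left) (rule top_greatest)
  then show ?thesis
    by (simp add: top_mult mult.commute)
qed

lemma mult_mono_both: "x \<le> y \<Longrightarrow> u \<le> v \<Longrightarrow> x * u \<le> y * v"
  using mult_mono_left[of x y u] mult_mono_left[of u v y]
  by (metis mult.commute order_trans)

lemma sup_mult_le: "x * z \<le> w \<Longrightarrow> y * z \<le> w \<Longrightarrow> sup x y * z \<le> w"
  using residuation by simp

lemma sup_mult_sup_le: "sup x z * sup y z \<le> sup (x * y) z"
proof (rule sup_mult_le)
  have "sup y z * x \<le> sup (x * y) z"
    by (rule sup_mult_le) (simp add: mult.commute, rule le_supI2, rule mult_le_left)
  then show "x * sup y z \<le> sup (x * y) z"
    by (simp add: mult.commute)
  show "z * sup y z \<le> sup (x * y) z"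
    by (rule le_supI2) (rule mult_le_left)
qed

end

lemma rl_filterI:
  assumes "a \<in> F" "\<And>x y. x \<in> F \<Longrightarrow> y \<in> F \<Longrightarrow> x * y \<in> F" "\<And>x y. x \<in> F \<Longrightarrow> x \<le> y \<Longrightarrow> y \<in> F"
  shows "rl_filter F"
  unfolding rl_filter_def using assms sup_ge1 by blast

lemma rl_filter_up: "rl_filter F \<Longrightarrow> x \<in> F \<Longrightarrow> x \<le> y \<Longrightarrow> y \<in> F"
  unfolding rl_filter_def by (metis sup.absorb2)

lemma rl_filter_mult: "rl_filter F \<Longrightarrow> x \<in> F \<Longrightarrow> y \<in> F \<Longrightarrow> x * y \<in> F"
  unfolding rl_filter_def by blast

lemma rl_filter_top: "rl_filter F \<Longrightarrow> top \<in> F"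
  using rl_filter_up top_greatest unfolding rl_filter_def by blast

lemma proper_filter_iff_bot: "proper_filter F \<longleftrightarrow> rl_filter F \<and> bot \<notin> F"
  unfolding proper_filter_def using rl_filter_up[of F bot] by auto

lemma rl_filter_singleton_top: "rl_filter {top :: 'a::residuated_lattice}"
  by (rule rl_filterI) (auto simp: top_mult top_unique)

lemma rl_filter_Inter:
  assumes "\<And>F. F \<in> \<F> \<Longrightarrow> rl_filter F"
  shows "rl_filter (\<Inter>\<F>)"
proof (rule rl_filterI)
  show "top \<in> \<Inter>\<F>"
    using assms rl_filter_top by blast
qed (use assms in \<open>blast intro: rl_filter_mult rl_filter_up\<close>)+

text \<open>
  The residual of a filter by an element. It stands in for the filter generated by \<open>F\<close> and one further
  element, and avoids the powers of that element which occur in explicit descriptions.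
\<close>

lemma rl_filter_residual:
  assumes "rl_filter F"
  shows "rl_filter {z. sup z a \<in> F}"
proof (rule rl_filterI)
  show "top \<in> {z. sup z a \<in> F}"
    using assms rl_filter_top by simp
  show "x * y \<in> {z. sup z a \<in> F}" if "x \<in> {z. sup z a \<in> F}" "y \<in> {z. sup z a \<in> F}" for x y
    using that assms rl_filter_up[OF assms _ sup_mult_sup_le] rl_filter_mult by blast
  show "y \<in> {z. sup z a \<in> F}" if "x \<in> {z. sup z a \<in> F}" "x \<le> y" for x y
    using that rl_filter_up[OF assms] by (auto intro: sup_mono)
qed

lemma rl_filter_products:
  assumes "rl_filter F" "rl_filter G"
  shows "rl_filter {z. \<exists>f\<in>F. \<exists>g\<in>G. f * g \<le> z}"
proof (rule rl_filterI)
  let ?H = "{z. \<exists>f\<in>F. \<exists>g\<in>G. f * g \<le> z}"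
  show "top \<in> ?H"
    using rl_filter_top[OF assms(1)] rl_filter_top[OF assms(2)] top_greatest by blast
  show "x * y \<in> ?H" if "x \<in> ?H" "y \<in> ?H" for x y
  proof -
    obtain f g f' g' where fg: "f \<in> F" "g \<in> G" "f' \<in> F" "g' \<in> G"
        and le: "f * g \<le> x" "f' * g' \<le> y"
      using \<open>x \<in> ?H\<close> \<open>y \<in> ?H\<close> by blast
    have "(f * f') * (g * g') = (f * g) * (f' * g')"
      by (simp add: ac_simps)
    then have "(f * f') * (g * g') \<le> x * y"
      using mult_mono_both[OF le] by simp
    then show ?thesis
      using fg assms rl_filter_mult by blast
  qed
  show "y \<in> ?H" if "x \<in> ?H" "x \<le> y" for x y
    using that order_trans by blast
qed

section \<open>Prime and maximal filters\<close>

text \<open>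
  If \<open>sup x y\<close> is in \<open>P\<close> but neither \<open>x\<close> nor \<open>y\<close> is, two residuals in a row produce an element of
  \<open>S\<close> in \<open>P\<close>: the residual by \<open>y\<close> is strictly larger than \<open>P\<close> because of \<open>x\<close>, so it contains
  some \<open>s\<close> in \<open>S\<close>; the residual by \<open>s\<close> then contains \<open>y\<close>, so it contains some \<open>t\<close> in \<open>S\<close>, and
  \<open>sup t s\<close> is in both \<open>S\<close> and \<open>P\<close>.
\<close>

lemma prime_filter_if_maximal_disjoint:
  assumes S: "S \<noteq> {}" "\<And>s t. s \<in> S \<Longrightarrow> t \<in> S \<Longrightarrow> sup s t \<in> S"
    and P: "rl_filter P" "P \<inter> S = {}"
    and max: "\<And>F. rl_filter F \<Longrightarrow> P \<subseteq> F \<Longrightarrow> F \<inter> S = {} \<Longrightarrow> F = P"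
  shows "prime_filter P"
proof -
  have residual_meets: "\<exists>s\<in>S. sup s a \<in> P" if "sup b a \<in> P" "b \<notin> P" for a b
  proof -
    have "P \<subseteq> {z. sup z a \<in> P}"
      using rl_filter_up[OF P(1)] by auto
    then show ?thesis
      using max[OF rl_filter_residual[OF P(1), of a]] that by blast
  qed
  have "x \<in> P \<or> y \<in> P" if xy: "sup x y \<in> P" for x y
  proof (rule ccontr)
    assume no: "\<not> (x \<in> P \<or> y \<in> P)"
    obtain s where s: "s \<in> S" "sup s y \<in> P"
      using residual_meets xy no by blast
    then have "sup y s \<in> P"
      by (simp add: sup.commute)
    then obtain t where "t \<in> S" "sup t s \<in> P"
      using residual_meets no by blast
    then show False
      using S(2) s(1) P(2) by blast
  qed
  then show ?thesis
    using P S(1) unfolding prime_filter_def proper_filter_def by auto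
qed

lemma exists_maximal_disjoint_filter:
  assumes F: "rl_filter F" "F \<inter> S = {}"
  obtains P where "rl_filter P" "F \<subseteq> P" "P \<inter> S = {}"
    "\<And>H. rl_filter H \<Longrightarrow> P \<subseteq> H \<Longrightarrow> H \<inter> S = {} \<Longrightarrow> H = P"
proof -
  let ?A = "{H. rl_filter H \<and> F \<subseteq> H \<and> H \<inter> S = {}}"
  have "\<exists>P\<in>?A. \<forall>H\<in>?A. P \<subseteq> H \<longrightarrow> H = P"
  proof (rule subset_Zorn_nonempty)
    show "?A \<noteq> {}"
      using F by blast
  next
    fix C assume C: "C \<noteq> {}" "subset.chain ?A C"
    have mem: "\<And>H. H \<in> C \<Longrightarrow> rl_filter H \<and> F \<subseteq> H \<and> H \<inter> S = {}"
      and lin: "\<And>H K. H \<in> C \<Longrightarrow> K \<in> C \<Longrightarrow> H \<subseteq> K \<or> K \<subseteq> H"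
      using C(2) unfolding subset_chain_def by blast+
    have "rl_filter (\<Union>C)"
    proof (rule rl_filterI)
      show "top \<in> \<Union>C"
        using C(1) mem rl_filter_top by blast
      show "x * y \<in> \<Union>C" if "x \<in> \<Union>C" "y \<in> \<Union>C" for x y
      proof -
        obtain H K where HK: "H \<in> C" "K \<in> C" "x \<in> H" "y \<in> K"
          using \<open>x \<in> \<Union>C\<close> \<open>y \<in> \<Union>C\<close> by blast
        then have "\<exists>L\<in>C. x \<in> L \<and> y \<in> L"
          using lin by blast
        then show ?thesis
          using mem rl_filter_mult by blast
      qed
      show "y \<in> \<Union>C" if "x \<in> \<Union>C" "x \<le> y" for x y
        using that mem rl_filter_up by blast
    qed
    then show "\<Union>C \<in> ?A"
      using C(1) mem by blast
  qed
  then obtain P where P: "P \<in> ?A" "\<forall>H\<in>?A. P \<subseteq> H \<longrightarrow> H = P"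
    by blast
  show ?thesis
  proof (rule that[of P])
    show "H = P" if "rl_filter H" "P \<subseteq> H" "H \<inter> S = {}" for H
      using P that by auto
  qed (use P(1) in auto)
qed

lemma exists_prime_filter_disjoint:
  assumes "rl_filter F" "F \<inter> S = {}" "S \<noteq> {}" "\<And>s t. s \<in> S \<Longrightarrow> t \<in> S \<Longrightarrow> sup s t \<in> S"
  obtains P where "prime_filter P" "F \<subseteq> P" "P \<inter> S = {}"
proof -
  obtain P where P: "rl_filter P" "F \<subseteq> P" "P \<inter> S = {}"
      "\<And>H. rl_filter H \<Longrightarrow> P \<subseteq> H \<Longrightarrow> H \<inter> S = {} \<Longrightarrow> H = P"
    using exists_maximal_disjoint_filter[OF assms(1,2)] by blast
  have "prime_filter P"
    by (rule prime_filter_if_maximal_disjoint[OF assms(3,4) P(1,3,4)])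
  then show ?thesis
    using that P(2,3) by blast
qed

lemma exists_prime_filter_avoiding:
  assumes "rl_filter F" "a \<notin> F"
  obtains P where "prime_filter P" "F \<subseteq> P" "a \<notin> P"
  using exists_prime_filter_disjoint[of F "{a}"] assms by auto

lemma prime_filter_rl_filter: "prime_filter P \<Longrightarrow> rl_filter P"
  and prime_filter_bot: "prime_filter P \<Longrightarrow> bot \<notin> P"
  and prime_filter_sup: "prime_filter P \<Longrightarrow> sup x y \<in> P \<Longrightarrow> x \<in> P \<or> y \<in> P"
  unfolding prime_filter_def proper_filter_iff_bot by auto

lemma maximal_filter_prime:
  assumes "maximal_filter M"
  shows "prime_filter M"
  by (rule prime_filter_if_maximal_disjoint[of "{bot}"])
    (use assms in \<open>auto simp: maximal_filter_def proper_filter_iff_bot\<close>)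

lemma maximal_filter_eq: "maximal_filter M \<Longrightarrow> maximal_filter N \<Longrightarrow> M \<subseteq> N \<Longrightarrow> M = N"
  unfolding maximal_filter_def by blast

lemma exists_maximal_filter_above:
  assumes "proper_filter F"
  obtains M where "maximal_filter M" "F \<subseteq> M"
proof -
  obtain M where "rl_filter M" "F \<subseteq> M" "M \<inter> {bot} = {}"
      "\<And>H. rl_filter H \<Longrightarrow> M \<subseteq> H \<Longrightarrow> H \<inter> {bot} = {} \<Longrightarrow> H = M"
    using exists_maximal_disjoint_filter[of F "{bot}"] assms
    unfolding proper_filter_iff_bot by blast
  then show ?thesis
    using that[of M] unfolding maximal_filter_def proper_filter_iff_bot by blast
qed

text \<open>
  The elements \<open>sup x y\<close> with \<open>x \<notin> P\<close> and \<open>y \<notin> M\<close> are closed under joins because \<open>P\<close> and \<open>M\<close> are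
  prime. If \<open>top\<close> is not among them, a prime filter disjoint from them lies below both \<open>P\<close> and \<open>M\<close>;
  this is seen by taking one of the two joinands to be \<open>bot\<close>.
\<close>

lemma primes_have_common_lower_prime_or_separated:
  assumes P: "prime_filter P" and M: "prime_filter M"
  shows "(\<exists>Q. prime_filter Q \<and> Q \<subseteq> P \<and> Q \<subseteq> M) \<or> (\<exists>x y. x \<notin> P \<and> y \<notin> M \<and> sup x y = top)"
proof (rule disjCI)
  assume no: "\<not> (\<exists>x y. x \<notin> P \<and> y \<notin> M \<and> sup x y = top)"
  let ?S = "{z. \<exists>x y. x \<notin> P \<and> y \<notin> M \<and> z = sup x y}"
  obtain Q where Q: "prime_filter Q" "Q \<inter> ?S = {}"
  proof (rule exists_prime_filter_disjoint[OF rl_filter_singleton_top])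
    show "{top} \<inter> ?S = {}"
      using no by fastforce
    show "?S \<noteq> {}"
      using prime_filter_bot P M by blast
    show "sup s t \<in> ?S" if "s \<in> ?S" "t \<in> ?S" for s t
    proof -
      obtain x y x' y' where "x \<notin> P" "y \<notin> M" "x' \<notin> P" "y' \<notin> M" and st: "s = sup x y" "t = sup x' y'"
        using \<open>s \<in> ?S\<close> \<open>t \<in> ?S\<close> by blast
      then have "sup x x' \<notin> P" "sup y y' \<notin> M"
        using prime_filter_sup P M by blast+
      moreover have "sup s t = sup (sup x x') (sup y y')"
        using st by (simp add: ac_simps)
      ultimately show ?thesis
        by blast
    qed
  qed auto
  have "q \<in> P \<and> q \<in> M" if q: "q \<in> Q" for q
  proof -
    have "q = sup q bot" "q = sup bot q"
      by simp_all
    then show ?thesis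
      using Q(2) q prime_filter_bot[OF P] prime_filter_bot[OF M] by blast
  qed
  then show "\<exists>Q. prime_filter Q \<and> Q \<subseteq> P \<and> Q \<subseteq> M"
    using Q(1) by blast
qed

section \<open>Pure filters and the pure part\<close>

lemma sigma_rl_filter: "rl_filter (sigma F)"
  unfolding sigma_def by (rule rl_filter_Inter) (auto dest: prime_filter_rl_filter)

lemma sigma_subset_lower_prime:
  "prime_filter Q \<Longrightarrow> prime_filter P \<Longrightarrow> F \<subseteq> P \<Longrightarrow> Q \<subseteq> P \<Longrightarrow> sigma F \<subseteq> Q"
  unfolding sigma_def by blast

lemma sigma_subset:
  assumes "rl_filter F"
  shows "sigma F \<subseteq> F"
proof
  fix a assume a: "a \<in> sigma F"
  show "a \<in> F"
  proof (rule ccontr)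
    assume "a \<notin> F"
    then obtain P where "prime_filter P" "F \<subseteq> P" "a \<notin> P"
      using exists_prime_filter_avoiding assms by blast
    then show False
      using sigma_subset_lower_prime a by blast
  qed
qed

lemma pure_filter_push_down:
  "pure_filter H \<Longrightarrow> prime_filter P \<Longrightarrow> H \<subseteq> P \<Longrightarrow> prime_filter Q \<Longrightarrow> Q \<subseteq> P \<Longrightarrow> H \<subseteq> Q"
  using sigma_subset_lower_prime unfolding pure_filter_def by metis

lemma rho_subset_iff:
  assumes "rl_filter G"
  shows "rho F \<subseteq> G \<longleftrightarrow> (\<forall>H. pure_filter H \<longrightarrow> H \<subseteq> F \<longrightarrow> H \<subseteq> G)"
  unfolding rho_def filter_Join_def generated_filter_def using assms by blast

lemma pure_filter_subset_rho: "pure_filter H \<Longrightarrow> H \<subseteq> F \<Longrightarrow> H \<subseteq> rho F"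
  unfolding rho_def filter_Join_def generated_filter_def by blast

section \<open>The adjunction\<close>

lemma subset_Rad_imp_rho_subset:
  assumes G: "rl_filter G" and FG: "F \<subseteq> Rad G"
  shows "rho F \<subseteq> G"
  unfolding rho_subset_iff[OF G]
proof (intro allI impI subsetI)
  fix H a assume H: "pure_filter H" "H \<subseteq> F" and a: "a \<in> H"
  show "a \<in> G"
  proof (rule ccontr)
    assume "a \<notin> G"
    then obtain P where P: "prime_filter P" "G \<subseteq> P" "a \<notin> P"
      using exists_prime_filter_avoiding G by blast
    then obtain M where M: "maximal_filter M" "P \<subseteq> M"
      using exists_maximal_filter_above unfolding prime_filter_def by blast
    then have "F \<subseteq> M"
      using FG P(2) unfolding Rad_def by blast
    then have "H \<subseteq> P"
      using pure_filter_push_down H maximal_filter_prime M P(1) by blast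
    then show False
      using a P(3) by blast
  qed
qed

text \<open>
  Suppose \<open>F\<close> is not contained in \<open>M\<close>. The elements having a complement for the join outside \<open>M\<close>
  (those \<open>x\<close> with \<open>sup x y = top\<close> for some \<open>y \<notin> M\<close>) form a filter \<open>O\<close>. By the Gelfand property, a
  prime filter above \<open>F\<close> and \<open>M\<close> have no common prime filter below them, hence can be separated,
  which says that no prime filter above \<open>F\<close> contains \<open>O\<close>. So \<open>F\<close> and \<open>O\<close> together generate the
  whole algebra, say \<open>f * x \<le> bot\<close> with \<open>f \<in> F\<close> and \<open>x \<in> O\<close>. The witness \<open>y \<notin> M\<close> for \<open>x \<in> O\<close> is then
  in \<open>\<sigma>(F)\<close>: no prime filter below one above \<open>F\<close> can contain \<open>x\<close>.
\<close>

lemma gelfand_sigma_le_maximal: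
  fixes F M :: "'a::residuated_lattice set"
  assumes gelfand: "gelfand TYPE('a)" and F: "rl_filter F" and M: "maximal_filter M"
    and sub: "sigma F \<subseteq> M"
  shows "F \<subseteq> M"
proof (rule ccontr)
  assume FM: "\<not> F \<subseteq> M"
  note Mp = maximal_filter_prime[OF M]
  let ?O = "{x. \<exists>y. y \<notin> M \<and> sup x y = top}"
  have O: "rl_filter ?O"
  proof (rule rl_filterI)
    show "top \<in> ?O"
      using prime_filter_bot[OF Mp] by auto
    show "x * x' \<in> ?O" if "x \<in> ?O" "x' \<in> ?O" for x x'
    proof -
      obtain y y' where y: "y \<notin> M" "y' \<notin> M" "sup x y = top" "sup x' y' = top"
        using \<open>x \<in> ?O\<close> \<open>x' \<in> ?O\<close> by blast
      have "sup x (sup y y') = top" "sup x' (sup y y') = top"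
        using y by (metis sup.assoc sup.commute sup_top_left)+
      then have "sup (x * x') (sup y y') = top"
        using sup_mult_sup_le[of x "sup y y'" x'] by (simp add: top_mult top_unique)
      then show ?thesis
        using y prime_filter_sup[OF Mp] by blast
    qed
    show "x' \<in> ?O" if "x \<in> ?O" "x \<le> x'" for x x'
    proof -
      obtain y where y: "y \<notin> M" "sup x y = top"
        using \<open>x \<in> ?O\<close> by blast
      then have "sup x' y = top"
        using sup_mono[OF \<open>x \<le> x'\<close> order_refl[of y]] by (simp add: top_unique)
      then show ?thesis
        using y(1) by blast
    qed
  qed
  have not_both: "\<not> ?O \<subseteq> P" if P: "prime_filter P" "F \<subseteq> P" for P
  proof -
    have "\<not> (\<exists>Q. prime_filter Q \<and> Q \<subseteq> P \<and> Q \<subseteq> M)"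
    proof
      assume "\<exists>Q. prime_filter Q \<and> Q \<subseteq> P \<and> Q \<subseteq> M"
      then obtain Q where Q: "prime_filter Q" "Q \<subseteq> P" "Q \<subseteq> M"
        by blast
      obtain N where N: "maximal_filter N" "P \<subseteq> N"
        using exists_maximal_filter_above P(1) unfolding prime_filter_def by blast
      then have "N = M"
        using gelfand Q M unfolding gelfand_def by blast
      then show False
        using N(2) P(2) FM by blast
    qed
    then show ?thesis
      using primes_have_common_lower_prime_or_separated[OF P(1) Mp] by blast
  qed
  let ?J = "{z. \<exists>f\<in>F. \<exists>x\<in>?O. f * x \<le> z}"
  have "bot \<in> ?J"
  proof (rule ccontr)
    assume "bot \<notin> ?J"
    then obtain P where P: "prime_filter P" "?J \<subseteq> P"
      by (rule exists_prime_filter_avoiding[OF rl_filter_products[OF F O]])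
    have "F \<subseteq> ?J"
    proof
      fix f assume "f \<in> F"
      moreover have "f * top \<le> f"
        by (rule mult_le_left)
      ultimately show "f \<in> ?J"
        using rl_filter_top[OF O] by blast
    qed
    moreover have "?O \<subseteq> ?J"
    proof
      fix x assume "x \<in> ?O"
      moreover have "top * x \<le> x"
        by (simp add: top_mult)
      ultimately show "x \<in> ?J"
        using rl_filter_top[OF F] by blast
    qed
    ultimately show False
      using not_both[OF P(1)] P(2) by (meson order_trans)
  qed
  then obtain f x y where f: "f \<in> F" "f * x \<le> bot" and y: "y \<notin> M" "sup x y = top"
    by blast
  have "y \<in> sigma F"
    unfolding sigma_def
  proof (intro InterI, clarify)
    fix Q P assume Q: "prime_filter Q" and P: "prime_filter P" "F \<subseteq> P" "Q \<subseteq> P"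
    have "x \<notin> P"
      using P f rl_filter_mult rl_filter_up prime_filter_rl_filter prime_filter_bot by blast
    moreover have "sup x y \<in> Q"
      using Q y(2) rl_filter_top prime_filter_rl_filter by metis
    ultimately show "y \<in> Q"
      using prime_filter_sup[OF Q] P(3) by blast
  qed
  then show False
    using y(1) sub by blast
qed

text \<open>
  A prime filter above \<open>\<sigma>(F)\<close> extends to a maximal filter, and that is a prime filter above \<open>F\<close>
  itself by the previous lemma.
  So \<open>\<sigma>(F)\<close> and \<open>\<sigma>(\<sigma>(F))\<close> are intersections over the same prime filters.
\<close>

lemma gelfand_sigma_pure:
  fixes F :: "'a::residuated_lattice set"
  assumes gelfand: "gelfand TYPE('a)" and F: "rl_filter F"
  shows "pure_filter (sigma F)"
proof -
  have "sigma F \<subseteq> Q" if Q: "prime_filter Q" and P: "prime_filter P" "sigma F \<subseteq> P" "Q \<subseteq> P" for Q P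
  proof -
    obtain M where M: "maximal_filter M" "P \<subseteq> M"
      using exists_maximal_filter_above P(1) unfolding prime_filter_def by blast
    then have "F \<subseteq> M"
      using gelfand_sigma_le_maximal[OF gelfand F] P(2) by blast
    then show ?thesis
      using sigma_subset_lower_prime[OF Q maximal_filter_prime] M P(3) by blast
  qed
  then have "sigma F \<subseteq> sigma (sigma F)"
    unfolding sigma_def[of "sigma F"] by blast
  then show ?thesis
    unfolding pure_filter_def using sigma_subset sigma_rl_filter by blast
qed

lemma gelfand_rho_subset_imp_subset_Rad:
  fixes F G :: "'a::residuated_lattice set"
  assumes "gelfand TYPE('a)" "rl_filter F" "rho F \<subseteq> G"
  shows "F \<subseteq> Rad G"
proof -
  have "sigma F \<subseteq> G"
    using pure_filter_subset_rho[OF gelfand_sigma_pure sigma_subset] assms by blast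
  then show ?thesis
    using gelfand_sigma_le_maximal assms(1,2) unfolding Rad_def by blast
qed

lemma adjunction_imp_gelfand:
  assumes adj: "\<And>F G :: 'a set. rl_filter F \<Longrightarrow> rl_filter G \<Longrightarrow> rho F \<subseteq> G \<Longrightarrow> F \<subseteq> Rad G"
  shows "gelfand TYPE('a::residuated_lattice)"
  unfolding gelfand_def
proof (intro allI impI)
  fix P :: "'a set" assume P: "prime_filter P"
  have unique: "M = N" if M: "maximal_filter M" "P \<subseteq> M" and N: "maximal_filter N" "P \<subseteq> N" for M N
  proof -
    have "rho M \<subseteq> P"
      unfolding rho_subset_iff[OF prime_filter_rl_filter[OF P]]
      using pure_filter_push_down maximal_filter_prime M P by blast
    then have "M \<subseteq> Rad N"
      using adj[of M N] N(2) M(1) N(1) prime_filter_rl_filter maximal_filter_prime by blast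
    then have "M \<subseteq> N"
      using N(1) unfolding Rad_def by blast
    then show ?thesis
      using maximal_filter_eq M(1) N(1) by blast
  qed
  obtain M where "maximal_filter M" "P \<subseteq> M"
    using exists_maximal_filter_above P unfolding prime_filter_def by blast
  then show "\<exists>!M. maximal_filter M \<and> P \<subseteq> M"
    using unique by blast
qed

theorem theorem4p8:
  "gelfand TYPE('a::residuated_lattice) \<longleftrightarrow>
    (\<forall>F G :: 'a set. rl_filter F \<longrightarrow> rl_filter G \<longrightarrow> (rho F \<subseteq> G \<longleftrightarrow> F \<subseteq> Rad G))"
  using gelfand_rho_subset_imp_subset_Rad subset_Rad_imp_rho_subset adjunction_imp_gelfand
  by metis

end
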